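(* Let $A$ be an algebra and let $I$ be a subsemigroup of $\mathrm{End}(A)$. Then $$\Omega(I)=\{(\lambda_f,\rho_f): f\in T(A,I)\}$$ if and only if every $\lambda\in\widetilde{\Lambda}(I)$ is left-balanced and every $\rho\in\widetilde{\mathrm{P}}(I)$ is right-balanced.
   Context: An algebra is a set $A$ with a collection of finitary operations; $\mathrm{End}(A)$ is its endomorphism monoid and $\mathcal{T}_A$ is the monoid of all maps $A\to A$. Maps of $A$ are written on the right and composed left to right. Subsemigroups are non-empty. Translations. A right translation of a semigroup $I$ is a map $\rho:I\to I$ (written on the right) with $(\alpha\beta)\rho=\alpha(\beta\rho)$ for all $\alpha,\beta\in I$; a left translation is a map $\lambda:I\to I$ (written on the left) with $\lambda(\alpha\beta)=\lambda(\alpha)\beta$ for all $\alpha,\beta\in I$. A pair $(\lambda,\rho)$ of a left and a right translation is a bi-translation (is linked) if $\alpha\lambda(\beta)=(\alpha\rho)\beta$ for all $\alpha,\beta\in I$. $\Omega(I)$ (the translational hull) is the set of all bi-translations, a semigroup under $(\lambda,\rho)(\lambda',\rho')=(\lambda\lambda',\rho\rho')$, where $(\lambda\lambda')(\alpha)=\lambda(\lambda'(\alpha))$ and $\alpha(\rho\rho')=(\alpha\rho)\rho'$. $\widetilde{\Lambda}(I)$ and $\widetilde{\mathrm{P}}(I)$ are the images of $\Omega(I)$ under projection to the first and second coordinates, respectively. $T(A,I)=\{f\in\mathcal{T}_A: f\alpha\in I \text{ and } \alpha f\in I\text{ for all }\alpha\in I\}$ is the idealiser of $I$ in $\mathcal{T}_A$.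 For such $f$, $\lambda_f(\alpha)=f\alpha$ and $\alpha\rho_f=\alpha f$ for $\alpha\in I$. A right translation $\rho$ of $I$ is right-balanced if, for all $a,b\in A$ and $\alpha,\beta\in I$, $a\alpha=b\beta$ implies $a(\alpha\rho)=b(\beta\rho)$. A left translation $\lambda$ of $I$ is left-balanced if for all $a\in A$ there exists $x_a\in A$ such that $a\lambda(\alpha)=x_a\alpha$ for all $\alpha\in I$. *)

theory Defs
  imports Main "HOL-Library.FuncSet"
begin

text \<open>
  Maps between carrier sets are extensional functions, so that equality of maps on the
  carrier is equality in HOL.  Maps of \<open>A\<close> are written on the right in the source:
  \<open>a f\<close> is \<open>f a\<close> here, and the product \<open>f g\<close>, composed from
  left to right, is \<open>rcomp A f g\<close>.
\<close>

definition full_trans :: "'a set \<Rightarrow> ('a \<Rightarrow> 'a) set" where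
  "full_trans A = A \<rightarrow>\<^sub>E A"

definition rcomp :: "'a set \<Rightarrow> ('a \<Rightarrow> 'a) \<Rightarrow> ('a \<Rightarrow> 'a) \<Rightarrow> 'a \<Rightarrow> 'a" where
  "rcomp A f g = compose A g f"

text \<open>
  A collection of finitary operations is a set of pairs \<open>(n, p)\<close>, where \<open>n\<close>
  is the arity (possibly 0) and \<open>p\<close> is applied to argument lists of length \<open>n\<close>.
  The values of \<open>p\<close> on other lists are irrelevant.
\<close>

type_synonym 'a operation = "nat \<times> ('a list \<Rightarrow> 'a)"

definition algebra :: "'a set \<Rightarrow> 'a operation set \<Rightarrow> bool" where
  "algebra A F \<longleftrightarrow>
     (\<forall>(n, p) \<in> F. \<forall>xs. length xs = n \<and> set xs \<subseteq> A \<longrightarrow> p xs \<in> A)"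

definition endomorphisms :: "'a set \<Rightarrow> 'a operation set \<Rightarrow> ('a \<Rightarrow> 'a) set" where
  "endomorphisms A F =
     {f \<in> full_trans A. \<forall>(n, p) \<in> F. \<forall>xs. length xs = n \<and> set xs \<subseteq> A \<longrightarrow>
        f (p xs) = p (map f xs)}"

definition subsemigroup :: "('s \<Rightarrow> 's \<Rightarrow> 's) \<Rightarrow> 's set \<Rightarrow> 's set \<Rightarrow> bool" where
  "subsemigroup m I S \<longleftrightarrow> I \<noteq> {} \<and> I \<subseteq> S \<and> (\<forall>\<alpha>\<in>I. \<forall>\<beta>\<in>I. m \<alpha> \<beta> \<in> I)"

text \<open>
  Translations of a semigroup with carrier \<open>I\<close> and multiplication \<open>m\<close>.
  Right translations are written on the right in the source: \<open>\<alpha> \<rho>\<close> is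
  \<open>\<rho> \<alpha>\<close> here.
\<close>

definition right_translation :: "('s \<Rightarrow> 's \<Rightarrow> 's) \<Rightarrow> 's set \<Rightarrow> ('s \<Rightarrow> 's) \<Rightarrow> bool" where
  "right_translation m I \<rho> \<longleftrightarrow>
     \<rho> \<in> I \<rightarrow>\<^sub>E I \<and> (\<forall>\<alpha>\<in>I. \<forall>\<beta>\<in>I. \<rho> (m \<alpha> \<beta>) = m \<alpha> (\<rho> \<beta>))"

definition left_translation :: "('s \<Rightarrow> 's \<Rightarrow> 's) \<Rightarrow> 's set \<Rightarrow> ('s \<Rightarrow> 's) \<Rightarrow> bool" where
  "left_translation m I l \<longleftrightarrow>
     l \<in> I \<rightarrow>\<^sub>E I \<and> (\<forall>\<alpha>\<in>I. \<forall>\<beta>\<in>I. l (m \<alpha> \<beta>) = m (l \<alpha>) \<beta>)"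

definition linked :: "('s \<Rightarrow> 's \<Rightarrow> 's) \<Rightarrow> 's set \<Rightarrow> ('s \<Rightarrow> 's) \<Rightarrow> ('s \<Rightarrow> 's) \<Rightarrow> bool" where
  "linked m I l \<rho> \<longleftrightarrow> (\<forall>\<alpha>\<in>I. \<forall>\<beta>\<in>I. m \<alpha> (l \<beta>) = m (\<rho> \<alpha>) \<beta>)"

definition translational_hull ::
    "('s \<Rightarrow> 's \<Rightarrow> 's) \<Rightarrow> 's set \<Rightarrow> (('s \<Rightarrow> 's) \<times> ('s \<Rightarrow> 's)) set" where
  "translational_hull m I =
     {(l, \<rho>). left_translation m I l \<and> right_translation m I \<rho> \<and> linked m I l \<rho>}"

definition hull_left :: "('s \<Rightarrow> 's \<Rightarrow> 's) \<Rightarrow> 's set \<Rightarrow> ('s \<Rightarrow> 's) set" where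
  "hull_left m I = fst ` translational_hull m I"

definition hull_right :: "('s \<Rightarrow> 's \<Rightarrow> 's) \<Rightarrow> 's set \<Rightarrow> ('s \<Rightarrow> 's) set" where
  "hull_right m I = snd ` translational_hull m I"

definition idealiser :: "'a set \<Rightarrow> ('a \<Rightarrow> 'a) set \<Rightarrow> ('a \<Rightarrow> 'a) set" where
  "idealiser A I =
     {f \<in> full_trans A. \<forall>\<alpha>\<in>I. rcomp A f \<alpha> \<in> I \<and> rcomp A \<alpha> f \<in> I}"

definition left_mult :: "'a set \<Rightarrow> ('a \<Rightarrow> 'a) set \<Rightarrow> ('a \<Rightarrow> 'a) \<Rightarrow> ('a \<Rightarrow> 'a) \<Rightarrow> ('a \<Rightarrow> 'a)" where
  "left_mult A I f = (\<lambda>\<alpha>\<in>I. rcomp A f \<alpha>)"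

definition right_mult :: "'a set \<Rightarrow> ('a \<Rightarrow> 'a) set \<Rightarrow> ('a \<Rightarrow> 'a) \<Rightarrow> ('a \<Rightarrow> 'a) \<Rightarrow> ('a \<Rightarrow> 'a)" where
  "right_mult A I f = (\<lambda>\<alpha>\<in>I. rcomp A \<alpha> f)"

definition right_balanced ::
    "'a set \<Rightarrow> ('a \<Rightarrow> 'a) set \<Rightarrow> (('a \<Rightarrow> 'a) \<Rightarrow> ('a \<Rightarrow> 'a)) \<Rightarrow> bool" where
  "right_balanced A I \<rho> \<longleftrightarrow>
     (\<forall>a\<in>A. \<forall>b\<in>A. \<forall>\<alpha>\<in>I. \<forall>\<beta>\<in>I. \<alpha> a = \<beta> b \<longrightarrow> \<rho> \<alpha> a = \<rho> \<beta> b)"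

definition left_balanced ::
    "'a set \<Rightarrow> ('a \<Rightarrow> 'a) set \<Rightarrow> (('a \<Rightarrow> 'a) \<Rightarrow> ('a \<Rightarrow> 'a)) \<Rightarrow> bool" where
  "left_balanced A I l \<longleftrightarrow> (\<forall>a\<in>A. \<exists>x\<in>A. \<forall>\<alpha>\<in>I. l \<alpha> a = \<alpha> x)"

end

theory Submission imports Defs begin

text \<open>
  Pairs \<open>(\<lambda>\<^sub>f, \<rho>\<^sub>f)\<close> are always balanced bi-translations, \<open>x\<^sub>a = a f\<close> being the witness for
  left balance.  Conversely, a balanced \<open>(\<lambda>, \<rho>)\<close> is induced by the map \<open>f\<close> that sends \<open>b \<beta>\<close> to
  \<open>b (\<beta> \<rho>)\<close>, which is well defined by right balance, and any other point \<open>a\<close> to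
  some \<open>x\<^sub>a\<close> provided by left balance.  Then \<open>\<rho> = \<rho>\<^sub>f\<close> by construction, and \<open>\<lambda> = \<lambda>\<^sub>f\<close> holds
  at the points \<open>b \<beta>\<close> because \<open>(\<lambda>, \<rho>)\<close> is linked.
\<close>

lemma rcomp_apply: "a \<in> A \<Longrightarrow> rcomp A f g a = g (f a)"
  by (simp add: rcomp_def compose_def)

lemma rcomp_extensional: "rcomp A f g \<in> extensional A"
  by (simp add: rcomp_def)

text \<open>The product of \<open>g\<close> and \<open>h\<close> is cut down to \<open>A\<close> and
  is evaluated at \<open>f a\<close>, so \<open>f\<close> has to send \<open>A\<close> into
  \<open>A\<close>.\<close>

lemma rcomp_assoc:
  assumes "f \<in> full_trans A"
  shows "rcomp A (rcomp A f g) h = rcomp A f (rcomp A g h)"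
  using assms unfolding full_trans_def rcomp_def PiE_def
  by (blast intro: compose_assoc)

text \<open>The two translation laws and the linking law are associativity for the products f
  \<alpha> \<beta>, \<alpha> \<beta> f and \<alpha> f \<beta>.\<close>

lemma induced_bitranslation:
  assumes I: "I \<subseteq> full_trans A"
    and closed: "\<And>\<alpha> \<beta>. \<alpha> \<in> I \<Longrightarrow> \<beta> \<in> I \<Longrightarrow> rcomp A \<alpha> \<beta> \<in> I"
    and f: "f \<in> idealiser A I"
  shows "(left_mult A I f, right_mult A I f) \<in> translational_hull (rcomp A) I"
proof -
  have "f \<in> full_trans A" and "\<And>\<alpha>. \<alpha> \<in> I \<Longrightarrow> rcomp A f \<alpha> \<in> I \<and> rcomp A \<alpha> f \<in> I"
    using f by (auto simp: idealiser_def)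
  then show ?thesis
    using I closed
    by (auto simp: translational_hull_def left_translation_def right_translation_def linked_def
        left_mult_def right_mult_def rcomp_assoc subset_iff)
qed

lemma left_balanced_left_mult:
  assumes "f \<in> full_trans A"
  shows "left_balanced A I (left_mult A I f)"
  using assms by (auto simp: left_balanced_def left_mult_def rcomp_apply full_trans_def)

text \<open>The value of \<alpha> f at a is f applied to the point \<open>\<alpha> a\<close>, so it
  depends on that point alone.\<close>

lemma right_balanced_right_mult: "right_balanced A I (right_mult A I f)"
  by (auto simp: right_balanced_def right_mult_def rcomp_apply)

lemma balanced_bitranslation_induced:
  assumes I: "I \<subseteq> full_trans A"
    and hull: "(l, \<rho>) \<in> translational_hull (rcomp A) I"
    and lb: "left_balanced A I l"
    and rb: "right_balanced A I \<rho>"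
  obtains f where "f \<in> idealiser A I" "l = left_mult A I f" "\<rho> = right_mult A I f"
proof -
  have l: "l \<in> I \<rightarrow>\<^sub>E I" and \<rho>: "\<rho> \<in> I \<rightarrow>\<^sub>E I"
    and link: "\<And>\<alpha> \<beta>. \<alpha> \<in> I \<Longrightarrow> \<beta> \<in> I \<Longrightarrow> rcomp A \<alpha> (l \<beta>) = rcomp A (\<rho> \<alpha>) \<beta>"
    using hull by (auto simp: translational_hull_def left_translation_def
        right_translation_def linked_def)
  have maps: "\<alpha> \<in> A \<rightarrow>\<^sub>E A" if "\<alpha> \<in> I" for \<alpha>
    using I that by (auto simp: full_trans_def)
  \<comment> \<open>Here \<open>y\<close> is the future value of f at \<open>a\<close>: the second
    conjunct serves \<open>l\<close>, the third serves \<open>\<rho>\<close>. Having both in one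
    statement lets a single choice produce f.\<close>
  have "\<forall>a\<in>A. \<exists>y. y \<in> A \<and> (\<forall>\<alpha>\<in>I. l \<alpha> a = \<alpha> y) \<and> (\<forall>\<beta>\<in>I. \<forall>b\<in>A. \<beta> b = a \<longrightarrow> y = \<rho> \<beta> b)"
  proof
    fix a assume a: "a \<in> A"
    show "\<exists>y. y \<in> A \<and> (\<forall>\<alpha>\<in>I. l \<alpha> a = \<alpha> y) \<and> (\<forall>\<beta>\<in>I. \<forall>b\<in>A. \<beta> b = a \<longrightarrow> y = \<rho> \<beta> b)"
    proof (cases "\<exists>\<beta>\<in>I. \<exists>b\<in>A. \<beta> b = a")
      case True
      then obtain \<beta> b where \<beta>: "\<beta> \<in> I" and b: "b \<in> A" and "\<beta> b = a"
        by blast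
      \<comment> \<open>This is the linking equation for \<open>\<beta>\<close> and
        \<open>\<alpha>\<close>, evaluated at \<open>b\<close>.\<close>
      have "l \<alpha> a = \<alpha> (\<rho> \<beta> b)" if "\<alpha> \<in> I" for \<alpha>
        using link[OF \<beta> that] rcomp_apply[OF b] \<open>\<beta> b = a\<close> by metis
      moreover have "\<rho> \<beta> b \<in> A"
        using maps[of "\<rho> \<beta>"] \<rho> \<beta> b by auto
      moreover have "\<rho> \<beta> b = \<rho> \<gamma> c" if "\<gamma> \<in> I" "c \<in> A" "\<gamma> c = a" for \<gamma> c
        using rb[unfolded right_balanced_def, rule_format, OF b \<open>c \<in> A\<close> \<beta> \<open>\<gamma> \<in> I\<close>]
          \<open>\<beta> b = a\<close> \<open>\<gamma> c = a\<close> by simp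
      ultimately show ?thesis
        by (intro exI[of _ "\<rho> \<beta> b"] conjI ballI impI)
    next
      case False
      \<comment> \<open>Since \<open>a\<close> lies in no image, the condition involving
        \<open>\<rho>\<close> is vacuous and any witness of left balance will do.\<close>
      obtain x where "x \<in> A" "\<forall>\<alpha>\<in>I. l \<alpha> a = \<alpha> x"
        using lb[unfolded left_balanced_def, THEN bspec, OF a] by (elim bexE)
      with False show ?thesis
        by (intro exI[of _ x]) auto
    qed
  qed
  from bchoice[OF this] obtain g where
    "\<forall>a\<in>A. g a \<in> A \<and> (\<forall>\<alpha>\<in>I. l \<alpha> a = \<alpha> (g a)) \<and> (\<forall>\<beta>\<in>I. \<forall>b\<in>A. \<beta> b = a \<longrightarrow> g a = \<rho> \<beta> b)"
    by (elim exE)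
  then have g: "\<And>a. a \<in> A \<Longrightarrow> g a \<in> A"
    "\<And>a \<alpha>. a \<in> A \<Longrightarrow> \<alpha> \<in> I \<Longrightarrow> l \<alpha> a = \<alpha> (g a)"
    "\<And>\<beta> b. \<beta> \<in> I \<Longrightarrow> b \<in> A \<Longrightarrow> \<beta> b \<in> A \<Longrightarrow> g (\<beta> b) = \<rho> \<beta> b"
    by simp_all
  \<comment> \<open>Choice leaves \<open>g\<close> arbitrary off \<open>A\<close>; members of
    \<open>full_trans A\<close> are extensional.\<close>
  define f where "f = restrict g A"
  have left: "rcomp A f \<alpha> = l \<alpha>" if "\<alpha> \<in> I" for \<alpha>
  proof (rule extensionalityI[OF rcomp_extensional])
    show "l \<alpha> \<in> extensional A"
      using l that maps[of "l \<alpha>"] by (auto simp: PiE_def)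
  qed (use that g in \<open>simp add: rcomp_apply f_def\<close>)
  have right: "rcomp A \<alpha> f = \<rho> \<alpha>" if "\<alpha> \<in> I" for \<alpha>
  proof (rule extensionalityI[OF rcomp_extensional])
    show "\<rho> \<alpha> \<in> extensional A"
      using \<rho> that maps[of "\<rho> \<alpha>"] by (auto simp: PiE_def)
  next
    fix a assume "a \<in> A"
    moreover from this have "\<alpha> a \<in> A"
      using maps[OF that] by auto
    ultimately show "rcomp A \<alpha> f a = \<rho> \<alpha> a"
      using that g by (simp add: rcomp_apply f_def)
  qed
  show thesis
  proof
    \<comment> \<open>The products of \<open>f\<close> with \<alpha> are \<open>l \<alpha>\<close>
      and \<open>\<rho> \<alpha>\<close>, which lie in \<open>I\<close> because \<open>l\<close> and
      \<open>\<rho>\<close> map \<open>I\<close> into itself.\<close>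
    show "f \<in> idealiser A I"
      using g(1) l \<rho> left right by (auto simp: idealiser_def full_trans_def f_def)
    show "l = left_mult A I f"
      using l left by (auto simp: left_mult_def PiE_def cong: restrict_cong
          intro!: extensionalityI[of _ I])
    show "\<rho> = right_mult A I f"
      using \<rho> right by (auto simp: right_mult_def PiE_def cong: restrict_cong
          intro!: extensionalityI[of _ I])
  qed
qed

theorem theorem3p3:
  fixes A :: "'a set" and F :: "'a operation set" and I :: "('a \<Rightarrow> 'a) set"
  assumes "algebra A F"
    and "subsemigroup (rcomp A) I (endomorphisms A F)"
  shows "translational_hull (rcomp A) I
           = {(left_mult A I f, right_mult A I f) | f. f \<in> idealiser A I}
         \<longleftrightarrow> (\<forall>l \<in> hull_left (rcomp A) I. left_balanced A I l)
           \<and> (\<forall>\<rho> \<in> hull_right (rcomp A) I. right_balanced A I \<rho>)"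
proof -
  have I: "I \<subseteq> full_trans A"
    and closed: "\<And>\<alpha> \<beta>. \<alpha> \<in> I \<Longrightarrow> \<beta> \<in> I \<Longrightarrow> rcomp A \<alpha> \<beta> \<in> I"
    using assms(2) by (auto simp: subsemigroup_def endomorphisms_def)
  show ?thesis (is "?H = ?T \<longleftrightarrow> ?B")
  proof
    assume "?H = ?T"
    \<comment> \<open>Under the equality, every member of either projection is a multiplication by
      some \<open>f\<close> in the idealiser.\<close>
    then show ?B
      by (auto simp: hull_left_def hull_right_def idealiser_def
          left_balanced_left_mult right_balanced_right_mult)
  next
    assume B: ?B
    have "?T \<subseteq> ?H"
      using induced_bitranslation[OF I closed] by blast
    moreover have "p \<in> ?T" if "p \<in> ?H" for p
    proof -
      obtain l \<rho> where p: "p = (l, \<rho>)"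
        by fastforce
      have "left_balanced A I l" "right_balanced A I \<rho>"
        using B that p by (force simp: hull_left_def hull_right_def)+
      then show ?thesis
        using balanced_bitranslation_induced[OF I] that p by blast
    qed
    ultimately show "?H = ?T"
      by blast
  qed
qed

end
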